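(* Let $\Sigma$ be a nonempty set of integers, all of which are greater than $1$, with $|\Sigma|\le 3$. Then there exist a numerical semigroup $T$ and a nonzero element $x\in T$ such that $AS(x)=\Sigma$; that is, a natural number $m$ is the number of atoms (counted with repetition) in some decomposition of $x$ as a sum of atoms of $T$ if and only if $m\in\Sigma$.
   Context: Write $\mathbb{N}=\{0,1,2,\dots\}$. A numerical semigroup is a submonoid $T$ of $(\mathbb{N},+)$ (so $0\in T$) with finite complement in $\mathbb{N}$. An atom of $T$ is a nonzero element $a\in T$ such that $a=b+c$ with $b,c\in T$ implies $b=0$ or $c=0$. For a nonzero $x\in T$, the addendization set $AS(x)$ is the set of all positive integers $m$ such that $x=a_1+\dots+a_m$ for some (not necessarily distinct) atoms $a_1,\dots,a_m$ of $T$. *)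

theory Defs
  imports Main
begin

definition numerical_semigroup :: "nat set \<Rightarrow> bool" where
  "numerical_semigroup T \<longleftrightarrow>
     0 \<in> T \<and> (\<forall>a\<in>T. \<forall>b\<in>T. a + b \<in> T) \<and> finite (UNIV - T)"

definition is_atom :: "nat set \<Rightarrow> nat \<Rightarrow> bool" where
  "is_atom T a \<longleftrightarrow>
     a \<in> T \<and> a \<noteq> 0 \<and> (\<forall>b\<in>T. \<forall>c\<in>T. a = b + c \<longrightarrow> b = 0 \<or> c = 0)"

(* The list as holds the summands a_1, ..., a_m; repeated entries are allowed. *)
definition addendization_set :: "nat set \<Rightarrow> nat \<Rightarrow> nat set" where
  "addendization_set T x =
     {m. 0 < m \<and> (\<exists>as. length as = m \<and> (\<forall>a\<in>set as. is_atom T a) \<and> sum_list as = x)}"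

end

theory Submission
  imports Defs
begin

text \<open>
  Write \<open>N = K * \<Prod>\<Sigma>\<close> with \<open>K\<close> huge. For each \<open>m \<in> \<Sigma>\<close> take \<open>m\<close> generators
  \<open>N / m + \<epsilon>(m, i)\<close>, \<open>i < m\<close>, whose small perturbations \<open>\<epsilon>(m, i)\<close> add up to 0 within each
  block \<open>m\<close> but satisfy no other linear relation with small integer coefficients. A
  representation of \<open>N\<close> by generators has boundedly many summands, so its perturbations cancel;
  hence it uses all generators of a block equally often, and comparing sizes shows that it
  consists of exactly one copy of one block. A generator that decomposes properly could be
  replaced by its decomposition within its own block, so every generator is an atom. Adding all integers above \<open>N\<close> to the monoid
  generated makes it a numerical semigroup without affecting the decompositions of \<open>N\<close>.
\<close>

section \<open>Perturbations without small linear relations\<close>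

text \<open>Base-\<open>B\<close> digits: the weights amount to successive powers of
  \<open>B\<close>. Modulo \<open>B\<close>, a vanishing combination leaves only the coefficient of
  the weight 1, which is below \<open>B\<close> in absolute value and hence 0; dividing by
  \<open>B\<close> returns to the smaller index set.\<close>

lemma ex_dissociated_weights:
  fixes B :: int
  assumes "finite J" and "B > 0"
  shows "\<exists>w :: 'a \<Rightarrow> int. \<forall>d. (\<forall>j\<in>J. \<bar>d j\<bar> < B) \<longrightarrow> (\<Sum>j\<in>J. d j * w j) = 0 \<longrightarrow> (\<forall>j\<in>J. d j = 0)"
  using assms(1)
proof (induction J rule: finite_induct)
  case empty
  then show ?case by simp
next
  case (insert k J)
  then obtain w :: "'a \<Rightarrow> int" where
    w: "\<And>d. (\<forall>j\<in>J. \<bar>d j\<bar> < B) \<Longrightarrow> (\<Sum>j\<in>J. d j * w j) = 0 \<Longrightarrow> \<forall>j\<in>J. d j = 0"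
    by blast
  let ?w = "\<lambda>j. if j = k then 1 else B * w j"
  have w': "\<forall>j\<in>insert k J. d j = 0"
    if d: "\<forall>j\<in>insert k J. \<bar>d j\<bar> < B" and 0: "(\<Sum>j\<in>insert k J. d j * ?w j) = 0" for d
  proof -
    have "(\<Sum>j\<in>J. d j * ?w j) = (\<Sum>j\<in>J. B * (d j * w j))"
      using insert.hyps by (intro sum.cong) auto
    then have eq: "d k + B * (\<Sum>j\<in>J. d j * w j) = 0"
      using 0 insert.hyps by (simp add: sum_distrib_left)
    then have "B dvd d k"
      by (metis dvd_add_left_iff dvd_0_right dvd_triv_left)
    then have "d k = 0"
      using d dvd_imp_le_int[of "d k" B] by force
    moreover from this eq have "(\<Sum>j\<in>J. d j * w j) = 0"
      using assms(2) by simp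
    then have "\<forall>j\<in>J. d j = 0"
      using w d by blast
    ultimately show ?thesis by simp
  qed
  show ?case
    by (intro exI[of _ ?w] allI impI w')
qed

lemma sum_over_Sigma:
  assumes "finite A" and "\<And>x. x \<in> A \<Longrightarrow> finite (B x)"
  shows "(\<Sum>p\<in>Sigma A B. f p) = (\<Sum>x\<in>A. \<Sum>y\<in>B x. f (x, y))"
  using assms by (simp add: sum.Sigma)

text \<open>The weights with \<open>i > 0\<close> are dissociated, and the zero-sum condition fixes
  the one with \<open>i = 0\<close>. Eliminating it turns a relation with coefficients
  \<open>c\<close> into one with coefficients \<open>c (m, i) - c (m, 0)\<close>, still below
  \<open>B\<close> in absolute value, so these differences vanish.\<close>

lemma ex_block_weights:
  fixes S :: "nat set" and B :: int
  assumes "finite S" and "\<forall>m\<in>S. m > 0" and "B > 0"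
  defines "I \<equiv> SIGMA m:S. {..<m}"
  shows "\<exists>e :: nat \<times> nat \<Rightarrow> int. (\<forall>m\<in>S. (\<Sum>i<m. e (m, i)) = 0) \<and>
    (\<forall>c. (\<forall>j\<in>I. 0 \<le> c j \<and> c j < B) \<longrightarrow> (\<Sum>j\<in>I. c j * e j) = 0 \<longrightarrow>
      (\<forall>(m, i)\<in>I. c (m, i) = c (m, 0)))"
proof -
  define J where "J = (SIGMA m:S. {1..<m})"
  have "finite J"
    using assms(1) by (simp add: J_def)
  from ex_dissociated_weights[OF this assms(3)] obtain w :: "nat \<times> nat \<Rightarrow> int" where
    w: "\<And>d. (\<forall>j\<in>J. \<bar>d j\<bar> < B) \<Longrightarrow> (\<Sum>j\<in>J. d j * w j) = 0 \<Longrightarrow> \<forall>j\<in>J. d j = 0"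
    by blast
  define e where "e = (\<lambda>(m, i). if i = 0 then - (\<Sum>i=1..<m. w (m, i)) else w (m, i))"
  have split0: "(\<Sum>i<m. f i) = f 0 + (\<Sum>i=1..<m. f i)" if "m \<in> S" for m and f :: "nat \<Rightarrow> int"
    using assms(2) that by (simp add: lessThan_atLeast0 sum.atLeast_Suc_lessThan)
  have "(\<Sum>i<m. e (m, i)) = 0" if "m \<in> S" for m
    using that by (simp add: split0 e_def)
  moreover have "c (m, i) = c (m, 0)"
    if c: "\<forall>j\<in>I. 0 \<le> c j \<and> c j < B" and 0: "(\<Sum>j\<in>I. c j * e j) = 0" and mi: "(m, i) \<in> I"
    for c m i
  proof -
    define d where "d = (\<lambda>(m, i). c (m, i) - c (m, 0::nat))"
    have "(\<Sum>i<m. c (m, i) * e (m, i)) = (\<Sum>i=1..<m. d (m, i) * w (m, i))" if "m \<in> S" for m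
    proof -
      have "(\<Sum>i=1..<m. c (m, i) * e (m, i)) = (\<Sum>i=1..<m. c (m, i) * w (m, i))"
        by (intro sum.cong) (auto simp: e_def)
      then show ?thesis
        using that by (simp add: split0 e_def d_def sum_distrib_left left_diff_distrib sum_subtractf)
    qed
    then have "(\<Sum>j\<in>J. d j * w j) = (\<Sum>j\<in>I. c j * e j)"
      using assms(1) by (simp add: I_def J_def sum_over_Sigma)
    moreover have "\<forall>j\<in>J. \<bar>d j\<bar> < B"
    proof
      fix j assume "j \<in> J"
      then have "(fst j, snd j) \<in> I" "(fst j, 0) \<in> I"
        by (auto simp: I_def J_def)
      from c[rule_format, OF this(1)] c[rule_format, OF this(2)]
      show "\<bar>d j\<bar> < B" by (cases j) (auto simp: d_def abs_less_iff)
    qed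
    ultimately have "\<forall>j\<in>J. d j = 0"
      using w 0 by simp
    then show ?thesis
      using mi by (cases "i = 0") (auto simp: d_def J_def I_def)
  qed
  ultimately show ?thesis by blast
qed

section \<open>Generators whose only representations of \<open>N\<close> are the blocks\<close>

lemma sum_list_map_eq_sum_count_list:
  fixes f :: "'a \<Rightarrow> 'b::semiring_1"
  assumes "set xs \<subseteq> X" and "finite X"
  shows "sum_list (map f xs) = (\<Sum>x\<in>X. of_nat (count_list xs x) * f x)"
  using assms(1)
proof (induction xs)
  case (Cons y ys)
  have "(\<Sum>x\<in>X. of_nat (count_list (y # ys) x) * f x) =
      (\<Sum>x\<in>X. (if x = y then f x else 0) + of_nat (count_list ys x) * f x)"
    by (intro sum.cong) (auto simp: algebra_simps)
  then show ?case
    using Cons assms(2) by (simp add: sum.distrib)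
qed simp

text \<open>Two scales are separated: each generator is a multiple of \<open>K\<close> plus a
  perturbation, and the perturbations in a representation of \<open>N\<close> add up to less than
  \<open>K\<close> in absolute value, so divisibility by \<open>K\<close> makes them cancel.\<close>

lemma ex_block_generators:
  fixes S :: "nat set"
  assumes "finite S" and pos: "\<forall>m\<in>S. m > 0" and "S \<noteq> {}"
  defines "I \<equiv> SIGMA m:S. {..<m}"
  shows "\<exists>(a :: nat \<times> nat \<Rightarrow> nat) N. N > 0 \<and> (\<forall>j\<in>I. a j > 0) \<and> (\<forall>m\<in>S. (\<Sum>i<m. a (m, i)) = N) \<and>
    (\<forall>js. set js \<subseteq> I \<longrightarrow> sum_list (map a js) = N \<longrightarrow>
      (\<exists>m\<in>S. \<forall>j\<in>I. count_list js j = (if fst j = m then 1 else 0)))"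
proof -
  define M where "M = int (Max S)"
  have M: "int m \<le> M" if "m \<in> S" for m
    using that assms(1) by (simp add: M_def)
  have M0: "M > 0"
    using assms(3) pos M by fastforce
  \<comment> \<open>Every generator will exceed \<open>N / (2 * M)\<close>, so a representation of
    \<open>N\<close> has at most \<open>2 * M\<close> summands and all multiplicities are below
    \<open>2 * M + 1\<close>.\<close>
  obtain e :: "nat \<times> nat \<Rightarrow> int" where
    e0: "\<And>m. m \<in> S \<Longrightarrow> (\<Sum>i<m. e (m, i)) = 0" and
    e: "\<And>c m i. (\<forall>j\<in>I. 0 \<le> c j \<and> c j < 2 * M + 1) \<Longrightarrow> (\<Sum>j\<in>I. c j * e j) = 0 \<Longrightarrow>
      (m, i) \<in> I \<Longrightarrow> c (m, i) = c (m, 0)"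
    using ex_block_weights[OF assms(1) pos, of "2 * M + 1"] M0 unfolding I_def by fastforce
  have finI: "finite I"
    using assms(1) by (simp add: I_def)
  define E where "E = (\<Sum>j\<in>I. \<bar>e j\<bar>)"
  have E: "\<bar>e j\<bar> \<le> E" if "j \<in> I" for j
    unfolding E_def using finI that by (intro member_le_sum) auto
  have E0: "E \<ge> 0"
    unfolding E_def by (simp add: sum_nonneg)
  \<comment> \<open>A common multiple of the block sizes, so that \<open>q m\<close> is the exact
    quotient and \<open>K * q m\<close> equals \<open>N / m\<close>.\<close>
  define L where "L = (\<Prod>m\<in>S. int m)"
  define q where "q m = L div int m" for m :: nat
  have q: "int m * q m = L" if "m \<in> S" for m
    using that assms(1) by (simp add: q_def L_def dvd_prodI)
  have L0: "L > 0"
    using assms(1) pos by (simp add: L_def prod_pos)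
  \<comment> \<open>Just above \<open>2 * M * E\<close>, the largest possible size of a perturbation
    sum with multiplicities at most \<open>2 * M\<close>.\<close>
  define K where "K = 2 * M * E + 1"
  have K0: "K > 0"
    using M0 E0 by (simp add: K_def add_nonneg_pos)
  define N where "N = K * L"
  have N0: "N > 0"
    using K0 L0 by (simp add: N_def)
  define a where "a j = K * q (fst j) + e j" for j
  \<comment> \<open>In \<open>2 * M * a j\<close> the leading part gives at least
    \<open>2 * N\<close>, because block sizes are at most \<open>M\<close>; the perturbation removes
    at most \<open>2 * M * E < K \<le> N\<close>.\<close>
  have a: "2 * M * a j > N" if "j \<in> I" for j
  proof -
    have mS: "fst j \<in> S"
      using that by (auto simp: I_def)
    have "q (fst j) \<ge> 0"
      using L0 by (simp add: q_def pos_imp_zdiv_nonneg_iff pos_imp_zdiv_neg_iff div_int_pos_iff)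
    then have "L \<le> M * q (fst j)"
      using q[OF mS] M[OF mS] mult_right_mono[of "int (fst j)" M "q (fst j)"] by simp
    then have "K * L \<le> K * (M * q (fst j))"
      using K0 by simp
    moreover have "M * (- E) \<le> M * e j"
      using E[OF that] M0 by (intro mult_left_mono) auto
    moreover have "K \<le> K * L"
      using K0 L0 by simp
    ultimately show ?thesis
      by (simp add: a_def N_def K_def algebra_simps)
  qed
  have a0: "a j > 0" if "j \<in> I" for j
  proof -
    have "0 < 2 * M * a j"
      using a[OF that] N0 by simp
    then show ?thesis
      using M0 by (simp add: zero_less_mult_iff)
  qed
  have blocks: "(\<Sum>i<m. a (m, i)) = N" if "m \<in> S" for m
    using e0[OF that] q[OF that] by (simp add: a_def N_def sum.distrib algebra_simps)
  have main: "\<exists>m\<in>S. \<forall>j\<in>I. count_list js j = (if fst j = m then 1 else 0)"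
    if js: "set js \<subseteq> I" and sum: "sum_list (map a js) = N" for js
  proof -
    define c where "c j = int (count_list js j)" for j
    have "int (length js) * N \<le> 2 * M * sum_list (map a js)"
      using js by (induction js) (auto simp: algebra_simps dest!: a)
    then have len: "int (length js) \<le> 2 * M"
      using N0 by (simp add: sum)
    have c: "0 \<le> c j \<and> c j \<le> 2 * M" for j
      using len count_le_length[of js j] by (simp add: c_def)
    have "sum_list (map a js) = (\<Sum>j\<in>I. c j * a j)"
      using sum_list_map_eq_sum_count_list[OF js finI] by (simp add: c_def)
    then have eq: "K * (\<Sum>j\<in>I. c j * q (fst j)) + (\<Sum>j\<in>I. c j * e j) = K * L"
      using sum by (simp add: a_def N_def sum_distrib_left sum.distrib algebra_simps)
    have "\<bar>\<Sum>j\<in>I. c j * e j\<bar> \<le> (\<Sum>j\<in>I. \<bar>c j * e j\<bar>)"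
      by (rule sum_abs)
    also have "\<dots> \<le> (\<Sum>j\<in>I. 2 * M * \<bar>e j\<bar>)"
      using c by (intro sum_mono) (simp add: abs_mult mult_right_mono)
    also have "\<dots> < K"
      by (simp add: K_def E_def sum_distrib_left)
    finally have small: "\<bar>\<Sum>j\<in>I. c j * e j\<bar> < K" .
    have "K dvd (\<Sum>j\<in>I. c j * e j)"
      using eq by (metis dvd_add_right_iff dvd_triv_left)
    with small have ce: "(\<Sum>j\<in>I. c j * e j) = 0"
      using dvd_imp_le_int[of "\<Sum>j\<in>I. c j * e j" K] by force
    have const: "c (m, i) = c (m, 0)" if "m \<in> S" "i < m" for m i
      using e[OF _ ce, of m i] c that by (auto simp: I_def less_le_trans zle_add1_eq_le)
    \<comment> \<open>Only leading parts remain. A block used \<open>c (m, 0)\<close> times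
      contributes \<open>c (m, 0) * m * q m = c (m, 0) * L\<close>, so the block multiplicities add
      up to 1.\<close>
    have "L = (\<Sum>j\<in>I. c j * q (fst j))"
      using eq ce K0 by simp
    also have "\<dots> = (\<Sum>m\<in>S. \<Sum>i<m. c (m, i) * q m)"
      using assms(1) by (simp add: I_def sum_over_Sigma)
    also have "\<dots> = (\<Sum>m\<in>S. c (m, 0) * L)"
    proof (intro sum.cong refl)
      fix m assume "m \<in> S"
      then have "(\<Sum>i<m. c (m, i) * q m) = (\<Sum>i<m. c (m, 0) * q m)"
        by (intro sum.cong arg_cong2[of _ _ _ _ "(*)"] refl const) auto
      then show "(\<Sum>i<m. c (m, i) * q m) = c (m, 0) * L"
        using q[OF \<open>m \<in> S\<close>] by (simp add: mult.left_commute)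
    qed
    finally have "L * 1 = L * (\<Sum>m\<in>S. c (m, 0))"
      by (simp add: sum_distrib_left mult.commute)
    then have "(\<Sum>m\<in>S. c (m, 0)) = 1"
      using L0 by (metis mult_left_cancel less_irrefl)
    then have "(\<Sum>m\<in>S. count_list js (m, 0)) = 1"
      unfolding c_def of_nat_sum[symmetric] by linarith
    then obtain m where "m \<in> S" "\<forall>m'\<in>S. count_list js (m', 0) = (if m' = m then 1 else 0)"
      using assms(1) sum_eq_1_iff by (metis (lifting))
    then show ?thesis
      using const by (intro bexI[of _ m]) (force simp: c_def I_def simp del: of_nat_eq_iff)+
  qed
  \<comment> \<open>The perturbations can be negative, hence the work over the integers; positivity
    of \<open>a\<close> allows the return to \<open>nat\<close>.\<close>
  have int_a: "int (nat (a j)) = a j" if "j \<in> I" for j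
    using a0[OF that] by simp
  show ?thesis
  proof (intro exI[of _ "\<lambda>j. nat (a j)"] exI[of _ "nat N"] conjI ballI allI impI)
    show "(\<Sum>i<m. nat (a (m, i))) = nat N" if "m \<in> S" for m
    proof -
      have "int (\<Sum>i<m. nat (a (m, i))) = (\<Sum>i<m. a (m, i))"
        unfolding of_nat_sum using that by (intro sum.cong int_a) (auto simp: I_def)
      then show ?thesis using blocks[OF that] by (metis nat_int)
    qed
    show "\<exists>m\<in>S. \<forall>j\<in>I. count_list js j = (if fst j = m then 1 else 0)"
      if "set js \<subseteq> I" "sum_list (map (\<lambda>j. nat (a j)) js) = nat N" for js
    proof (rule main[OF that(1)])
      have "sum_list (map a js) = int (sum_list (map (\<lambda>j. nat (a j)) js))"
        using that(1) by (induction js) (auto simp: int_a simp del: int_nat_eq)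
      then show "sum_list (map a js) = N"
        using that(2) N0 by simp
    qed
  qed (use N0 a0 in auto)
qed

section \<open>Completing the monoid to a numerical semigroup\<close>

text \<open>The tail makes the complement finite but takes no part in sums up to \<open>x\<close>,
  where \<open>T\<close> is just the generated monoid. There the atoms are exactly the generators,
  and all summands of \<open>x\<close> lie in that range.\<close>

lemma addendization_set_truncated_monoid:
  fixes a :: "'i \<Rightarrow> nat"
  assumes pos: "\<And>j. j \<in> I \<Longrightarrow> a j > 0" and le: "\<And>j. j \<in> I \<Longrightarrow> a j \<le> x"
    and atoms: "\<And>j js. j \<in> I \<Longrightarrow> set js \<subseteq> I \<Longrightarrow> sum_list (map a js) = a j \<Longrightarrow> length js = 1"
    and x: "x > 0"
  defines "T \<equiv> (\<lambda>js. sum_list (map a js)) ` lists I \<union> {x<..}"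
  shows "numerical_semigroup T"
    and "addendization_set T x = length ` {js \<in> lists I. sum_list (map a js) = x}"
proof -
  have sum_in: "sum_list (map a js) \<in> T" if "js \<in> lists I" for js
    using that by (auto simp: T_def)
  have T_le: "\<exists>js\<in>lists I. n = sum_list (map a js)" if "n \<in> T" "n \<le> x" for n
    using that by (auto simp: T_def)
  show "numerical_semigroup T"
    unfolding numerical_semigroup_def
  proof (intro conjI ballI)
    show "0 \<in> T"
      using sum_in[of "[]"] by simp
    show "b + c \<in> T" if bc: "b \<in> T" "c \<in> T" for b c
    proof (cases "b + c \<le> x")
      case True
      then obtain js ks where "js \<in> lists I" "ks \<in> lists I"
        "b = sum_list (map a js)" "c = sum_list (map a ks)"
        using T_le bc by (metis add_leE)
      then show ?thesis
        using sum_in[of "js @ ks"] by simp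
    qed (simp add: T_def)
    show "finite (UNIV - T)"
      by (rule finite_subset[of _ "{..x}"]) (auto simp: T_def)
  qed
  have atom: "is_atom T n \<longleftrightarrow> n \<in> a ` I" if nx: "n \<le> x" for n
  proof
    assume n: "is_atom T n"
    then obtain js where js: "js \<in> lists I" "n = sum_list (map a js)"
      using T_le[OF _ nx] by (auto simp: is_atom_def)
    with n obtain k ks where k: "js = k # ks"
      by (cases js) (auto simp: is_atom_def)
    with js have "k \<in> I" "ks \<in> lists I" by auto
    \<comment> \<open>Split off the first generator: \<open>a k\<close> is nonzero, so atomicity
      forces the remaining sum to be 0.\<close>
    then have "sum_list (map a ks) = 0"
      using n js(2) sum_in[of "[k]"] sum_in[of ks] pos[of k] by (auto simp: is_atom_def k)
    then have "n = a k"
      using js(2) k by (simp del: sum_list_eq_0_iff)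
    then show "n \<in> a ` I"
      using \<open>k \<in> I\<close> by blast
  next
    assume "n \<in> a ` I"
    then obtain j where j: "j \<in> I" "n = a j" by blast
    have "b = 0 \<or> c = 0" if bc: "b \<in> T" "c \<in> T" "n = b + c" for b c
    proof -
      obtain js ks where jk: "js \<in> lists I" "ks \<in> lists I"
        "b = sum_list (map a js)" "c = sum_list (map a ks)"
        using T_le bc nx by (metis add_leE)
      \<comment> \<open>With total length 1, one of the two lists is empty and its sum is 0.\<close>
      then have "length (js @ ks) = 1"
        using bc(3) j by (intro atoms[OF j(1)]) auto
      then show ?thesis
        using jk by (cases js) auto
    qed
    then show "is_atom T n"
      using j pos[OF j(1)] sum_in[of "[j]"] by (auto simp: is_atom_def)
  qed
  show "addendization_set T x = length ` {js \<in> lists I. sum_list (map a js) = x}"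
  proof (intro equalityI subsetI)
    fix m assume "m \<in> addendization_set T x"
    then obtain bs where bs: "length bs = m" "\<forall>b\<in>set bs. is_atom T b" "sum_list bs = x"
      by (auto simp: addendization_set_def)
    then have "\<forall>b\<in>set bs. \<exists>j. j \<in> I \<and> b = a j"
      using atom member_le_sum_list[of _ bs] by (auto simp: image_iff)
    then obtain g where "\<forall>b\<in>set bs. g b \<in> I \<and> b = a (g b)"
      by metis
    then have "map g bs \<in> lists I" "map a (map g bs) = bs"
      by (auto simp: map_idI)
    then show "m \<in> length ` {js \<in> lists I. sum_list (map a js) = x}"
      using bs by (intro image_eqI[of _ _ "map g bs"]) auto
  next
    fix m assume "m \<in> length ` {js \<in> lists I. sum_list (map a js) = x}"
    then obtain js where js: "js \<in> lists I" "sum_list (map a js) = x" "m = length js"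
      by blast
    then have "\<forall>b\<in>set (map a js). is_atom T b"
      using atom le by auto
    moreover have "m > 0"
      using js x by auto
    ultimately show "m \<in> addendization_set T x"
      using js unfolding addendization_set_def by (auto intro!: exI[of _ "map a js"])
  qed
qed

section \<open>Assembling the semigroup\<close>

theorem theorem3p7:
  fixes \<Sigma> :: "nat set"
  assumes "\<Sigma> \<noteq> {}"
    and "\<forall>m\<in>\<Sigma>. m > 1"
    and "finite \<Sigma>"
    and "card \<Sigma> \<le> 3"
  shows "\<exists>T x. numerical_semigroup T \<and> x \<in> T \<and> x \<noteq> 0 \<and> addendization_set T x = \<Sigma>"
proof -
  define I where "I = (SIGMA m:\<Sigma>. {..<m})"
  have "\<forall>m\<in>\<Sigma>. m > 0"
    using assms(2) by fastforce
  from ex_block_generators[OF assms(3) this assms(1)] obtain a :: "nat \<times> nat \<Rightarrow> nat" and N where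
    N: "N > 0" and pos: "\<And>j. j \<in> I \<Longrightarrow> a j > 0"
    and blocks: "\<And>m. m \<in> \<Sigma> \<Longrightarrow> (\<Sum>i<m. a (m, i)) = N"
    and uniq: "\<And>js. set js \<subseteq> I \<Longrightarrow> sum_list (map a js) = N \<Longrightarrow>
      \<exists>m\<in>\<Sigma>. \<forall>j\<in>I. count_list js j = (if fst j = m then 1 else 0)"
    unfolding I_def by metis
  have finI: "finite I"
    using assms(3) by (simp add: I_def)
  define block where "block m = map (Pair m) [0..<m]" for m :: nat
  have block: "set (block m) \<subseteq> I" "sum_list (map a (block m)) = N" "length (block m) = m"
    if "m \<in> \<Sigma>" for m
    using that blocks[OF that]
    by (auto simp: block_def I_def o_def sum_list_distinct_conv_sum_set lessThan_atLeast0)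
  have length_block: "length js = m"
    if js: "set js \<subseteq> I" and m: "m \<in> \<Sigma>" "\<forall>j\<in>I. count_list js j = (if fst j = m then 1 else 0)"
    for js m
  proof -
    have "length js = (\<Sum>j\<in>I. if fst j = m then 1 else 0)"
      using sum_count_set[OF js finI] m(2) by simp
    also have "\<dots> = (\<Sum>k\<in>\<Sigma>. \<Sum>i<k. if k = m then 1 else 0)"
      using assms(3) by (simp add: I_def sum_over_Sigma)
    also have "\<dots> = (\<Sum>k\<in>\<Sigma>. if k = m then m else 0)"
      by (intro sum.cong) auto
    also have "\<dots> = m"
      using assms(3) m(1) by simp
    finally show ?thesis .
  qed
  have len: "length js \<in> \<Sigma>" if js: "set js \<subseteq> I" "sum_list (map a js) = N" for js
    using uniq[OF js] length_block[OF js(1)] by metis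
  \<comment> \<open>Exchange: replacing \<open>j\<close> by \<open>js\<close> in its block
    represents \<open>N\<close> again, so the result has the multiplicities of some block
    \<open>k\<close>. A leftover entry shows \<open>k = m\<close>, and comparing lengths gives
    \<open>m - 1 + length js = m\<close>.\<close>
  have atoms: "length js = 1"
    if j: "j \<in> I" and js: "set js \<subseteq> I" "sum_list (map a js) = a j" for j js
  proof -
    obtain m i where mi: "j = (m, i)" "m \<in> \<Sigma>" "i < m"
      using j by (auto simp: I_def)
    let ?rest = "remove1 j (block m)"
    have jm: "j \<in> set (block m)"
      using mi by (auto simp: block_def)
    have sub: "set ?rest \<subseteq> I"
      using block(1)[OF mi(2)] set_remove1_subset by fastforce
    have "sum_list (map a (?rest @ js)) = N"
      using sum_list_map_remove1[OF jm, of a] block(2)[OF mi(2)] js(2) by simp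
    then obtain k where k: "k \<in> \<Sigma>" "\<forall>j\<in>I. count_list (?rest @ js) j = (if fst j = k then 1 else 0)"
      using uniq[of "?rest @ js"] sub js(1) by auto
    \<comment> \<open>Since \<open>m > 1\<close>, an entry of the block survives the removal of
      \<open>j\<close> and identifies the block.\<close>
    have "length ?rest > 0"
      using assms(2) mi(2) block(3)[OF mi(2)] jm by (simp add: length_remove1)
    then obtain l where l: "l \<in> set ?rest" by (cases ?rest) auto
    then have "l \<in> set (block m)" "l \<in> I"
      using sub set_remove1_subset by fast+
    then have "fst l = m" "count_list (?rest @ js) l > 0"
      using l count_list_0_iff[of "?rest @ js" l] by (auto simp: block_def simp del: count_list_append)
    with k \<open>l \<in> I\<close> have "k = m" by (auto split: if_splits)
    then have "length (?rest @ js) = m"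
      using length_block[of "?rest @ js" m] k sub js(1) by simp
    then show ?thesis
      using jm block(3)[OF mi(2)] mi(3) by (simp add: length_remove1)
  qed
  have le: "a j \<le> N" if "j \<in> I" for j
  proof -
    have "fst j \<in> \<Sigma>" "j \<in> set (block (fst j))"
      using that by (auto simp: I_def block_def)
    then show ?thesis
      using block(2) member_le_sum_list[of "a j" "map a (block (fst j))"] by auto
  qed
  define T where "T = (\<lambda>js. sum_list (map a js)) ` lists I \<union> {N<..}"
  have T: "numerical_semigroup T"
    "addendization_set T N = length ` {js \<in> lists I. sum_list (map a js) = N}"
    unfolding T_def
    by (rule addendization_set_truncated_monoid[of I a N]; use pos le atoms N in blast)+
  have "length ` {js \<in> lists I. sum_list (map a js) = N} = \<Sigma>"
  proof (intro equalityI subsetI)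
    fix m assume "m \<in> \<Sigma>"
    then show "m \<in> length ` {js \<in> lists I. sum_list (map a js) = N}"
      using block[of m] by (intro image_eqI[of _ _ "block m"]) auto
  qed (use len in auto)
  moreover obtain m where "m \<in> \<Sigma>"
    using assms(1) by blast
  then have "N \<in> T"
    using block[of m] unfolding T_def by (intro UnI1 image_eqI[of _ _ "block m"]) auto
  ultimately show ?thesis
    using T N by (intro exI[of _ T] exI[of _ N]) auto
qed

end
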